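(* There exists an infinite P-rankable set $A\subseteq\Sigma^*$ whose complement $\overline{A}$ is infinite but not $\mathrm{F}_{\mathrm{PR}}$-compressible.
   Context: $\Sigma=\{0,1\}$; strings are ordered in length-lexicographic order, and natural numbers are identified with strings in the standard way. For $A\subseteq\Sigma^*$, $\mathrm{rank}_A(y)=\|\{z\mid z\le y \wedge z\in A\}\|$. A (possibly partial) function $f$ is a ranking function for $A$ if $\mathrm{domain}(f)\supseteq A$ and $f(x)=\mathrm{rank}_A(x)$ for all $x\in A$ (no requirement for $x\notin A$). $A$ is P-rankable if it has a ranking function that is a total polynomial-time computable function. A (possibly partial) function $f$ is a compression function for $A$ if $\mathrm{domain}(f)\supseteq A$, $f(A)=\Sigma^*$, and $f$ is injective on $A$. $\mathrm{F}_{\mathrm{PR}}$ is the class of partial recursive functions from $\Sigma^*$ to $\Sigma^*$, and $A$ is $\mathrm{F}_{\mathrm{PR}}$-compressible if some $f\in\mathrm{F}_{\mathrm{PR}}$ is a compression function for $A$. *)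

theory Defs
  imports
    "HOL-Library.List_Lenlexorder"
    "HOL-Library.Finite_Map"
    "HOL-Computational_Algebra.Polynomial"
begin

section \<open>Strings and natural numbers\<close>

text \<open>
  A string over the alphabet 0, 1 is a list of booleans (False is 0, True is 1), first
  letter at the head of the list. The relations \<open><\<close> and \<open>\<le>\<close> on strings are those of
  List_Lenlexorder, that is, the length-lexicographic order.
\<close>

type_synonym str = "bool list"

text \<open>
  The string \<open>w\<close> is identified with its position in the length-lexicographic enumeration:
  the empty string is 0, the strings 0, 1, 00, 01, ... are 1, 2, 3, 4, ...
\<close>

definition nat_of_str :: "str \<Rightarrow> nat" where
  "nat_of_str w = card {z. z < w}"

lemma str_le_length: "z \<le> w \<Longrightarrow> length z \<le> length w" for z w :: str
  by (cases z; cases w) (auto simp: Cons_le_Cons)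

lemma finite_str_le: "finite {z. z \<le> (w :: str)}"
proof (rule finite_subset)
  show "{z. z \<le> w} \<subseteq> {z. set z \<subseteq> UNIV \<and> length z \<le> length w}"
    by (auto dest: str_le_length)
  show "finite {z :: str. set z \<subseteq> UNIV \<and> length z \<le> length w}"
    by (rule finite_lists_length_le) simp
qed

lemma strict_mono_nat_of_str: "strict_mono nat_of_str"
proof (rule strict_monoI)
  fix v w :: str
  assume "v < w"
  then have "{z. z < v} \<subset> {z. z < w}" by auto
  moreover have "finite {z. z < w}"
    by (rule finite_subset[OF _ finite_str_le[of w]]) auto
  ultimately show "nat_of_str v < nat_of_str w"
    unfolding nat_of_str_def by (rule psubset_card_mono[rotated])
qed

lemma bij_nat_of_str: "bij nat_of_str"
proof (rule bijI)
  show "inj nat_of_str"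
    by (rule strict_mono_imp_inj_on[OF strict_mono_nat_of_str])
  have "\<exists>w. nat_of_str w = n" for n
  proof (induction n)
    case 0
    have "nat_of_str [] = 0" by (simp add: nat_of_str_def)
    then show ?case ..
  next
    case (Suc n)
    then obtain w where w: "nat_of_str w = n" ..
    define S where "S = {z. w < z \<and> z \<le> False # w}"
    define s where "s = Min S"
    have "w < False # w" by (cases w) (auto simp: Cons_less_Cons)
    then have "S \<noteq> {}" by (auto simp: S_def)
    moreover have fin: "finite S"
      unfolding S_def by (rule finite_subset[OF _ finite_str_le[of "False # w"]]) auto
    ultimately have "s \<in> S" unfolding s_def by (rule Min_in[rotated])
    then have ws: "w < s" and s_le: "s \<le> False # w" by (auto simp: S_def)
    have "z \<le> w" if "z < s" for z
    proof (rule ccontr)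
      assume "\<not> z \<le> w"
      then have "z \<in> S" using that s_le by (auto simp: S_def)
      then have "s \<le> z" unfolding s_def using fin by simp
      then show False using that by simp
    qed
    then have "{z. z < s} = insert w {z. z < w}" using ws by fastforce
    moreover have "finite {z. z < w}"
      by (rule finite_subset[OF _ finite_str_le[of w]]) auto
    ultimately have "nat_of_str s = Suc n" using w by (simp add: nat_of_str_def)
    then show ?case ..
  qed
  then show "surj nat_of_str" by (metis surjI)
qed


section \<open>Turing machines\<close>

text \<open>
  A machine is a deterministic single-tape Turing machine with a two-way infinite tape,
  given by its finite partial transition function. States and tape symbols are natural
  numbers, of which only finitely many occur in a given machine. State 0 is the start
  state, symbol 0 is the blank, and the machine halts when no transition applies.
\<close>

datatype direction = Move_Left | Stay | Move_Right

fun offset :: "direction \<Rightarrow> int" where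
  "offset Move_Left = -1"
| "offset Stay = 0"
| "offset Move_Right = 1"

type_synonym tm = "(nat \<times> nat, nat \<times> nat \<times> direction) fmap"

text \<open>A configuration consists of the state, the head position and the tape.\<close>

type_synonym config = "nat \<times> int \<times> (int \<Rightarrow> nat)"

definition bit_symbol :: "bool \<Rightarrow> nat" where
  "bit_symbol b = (if b then 2 else 1)"

definition init_config :: "str \<Rightarrow> config" where
  "init_config w =
    (0, 0, \<lambda>i. if 0 \<le> i \<and> i < int (length w) then bit_symbol (w ! nat i) else 0)"

definition halted :: "tm \<Rightarrow> config \<Rightarrow> bool" where
  "halted M = (\<lambda>(q, h, tape). fmlookup M (q, tape h) = None)"

text \<open>Halted configurations are fixed points of the step function.\<close>

definition step :: "tm \<Rightarrow> config \<Rightarrow> config" where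
  "step M = (\<lambda>(q, h, tape).
     case fmlookup M (q, tape h) of
       None \<Rightarrow> (q, h, tape)
     | Some (q', s, d) \<Rightarrow> (q', h + offset d, tape(h := s)))"

text \<open>
  The output of a halted configuration is the longest string of bits that starts at the
  head position and extends to the right.
\<close>

definition has_output :: "config \<Rightarrow> str \<Rightarrow> bool" where
  "has_output = (\<lambda>(q, h, tape) v.
     (\<forall>i < length v. tape (h + int i) = bit_symbol (v ! i)) \<and>
     tape (h + int (length v)) \<notin> range bit_symbol)"

definition computes_in :: "tm \<Rightarrow> str \<Rightarrow> nat \<Rightarrow> str \<Rightarrow> bool" where
  "computes_in M x t v \<longleftrightarrow>
     (let c = (step M ^^ t) (init_config x) in halted M c \<and> has_output c v)"

definition partial_recursive :: "(str \<rightharpoonup> str) \<Rightarrow> bool" where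
  "partial_recursive f \<longleftrightarrow>
     (\<exists>M. \<forall>x v. f x = Some v \<longleftrightarrow> (\<exists>t. computes_in M x t v))"

definition poly_time_computable :: "(str \<Rightarrow> str) \<Rightarrow> bool" where
  "poly_time_computable f \<longleftrightarrow>
     (\<exists>M (p :: nat poly). \<forall>x. \<exists>t \<le> poly p (length x). computes_in M x t (f x))"


text \<open>Every reachable configuration has exactly one output, so a machine computes a partial function
  whose domain is the set of inputs on which it halts.\<close>

lemma has_output_unique:
  assumes "has_output c v" "has_output c w"
  shows "v = w"
proof -
  obtain q h tape where c: "c = (q, h, tape)" by (cases c) auto
  have *: "length b \<le> length a" if "has_output c a" "has_output c b" for a b
  proof (rule ccontr)
    assume "\<not> length b \<le> length a"
    then have "tape (h + int (length a)) = bit_symbol (b ! length a)"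
      using that(2) by (simp add: has_output_def c)
    then show False using that(1) by (simp add: has_output_def c)
  qed
  have "length v = length w" using *[of v w] *[of w v] assms by simp
  moreover have "inj bit_symbol" by (auto simp: inj_def bit_symbol_def split: if_splits)
  ultimately show ?thesis
    using assms by (auto simp: has_output_def c intro!: nth_equalityI dest: injD)
qed

lemma step_halted: "halted M c \<Longrightarrow> (step M ^^ n) c = c"
  by (induction n) (auto simp: halted_def step_def split: prod.splits)

lemma computes_in_unique:
  assumes "computes_in M x t v" "computes_in M x u w"
  shows "v = w"
proof -
  have *: "(step M ^^ u) (init_config x) = (step M ^^ t) (init_config x)"
    if "t \<le> u" "halted M ((step M ^^ t) (init_config x))" for t u
  proof -
    obtain k where "u = k + t" using \<open>t \<le> u\<close> by (metis le_add_diff_inverse2)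
    then show ?thesis using step_halted[OF that(2), of k] by (simp add: funpow_add)
  qed
  show ?thesis
    using assms *[of t u] *[of u t]
    by (cases "t \<le> u") (auto simp: computes_in_def Let_def dest: has_output_unique)
qed

lemma finite_nonblank:
  "finite {i. snd (snd ((step M ^^ t) (init_config x))) i \<noteq> 0}"
proof (induction t)
  case 0
  have "{i. snd (snd (init_config x)) i \<noteq> 0} \<subseteq> {0..<int (length x)}"
    by (auto simp: init_config_def split: if_splits)
  then show ?case by (auto intro: finite_subset)
next
  case (Suc t)
  obtain q h tape where c: "(step M ^^ t) (init_config x) = (q, h, tape)"
    by (cases "(step M ^^ t) (init_config x)") auto
  have "{i. snd (snd (step M (q, h, tape))) i \<noteq> 0} \<subseteq> insert h {i. tape i \<noteq> 0}"
    by (auto simp: step_def split: option.splits if_splits)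
  then show ?case using Suc c by (auto intro: finite_subset)
qed

lemma ex_has_output:
  fixes M :: tm and x :: str and t :: nat
  defines "c \<equiv> (step M ^^ t) (init_config x)"
  shows "\<exists>v. has_output c v"
proof -
  obtain q h tape where c: "c = (q, h, tape)" by (cases c) auto
  have fin: "finite {i. tape i \<noteq> 0}"
    using finite_nonblank[where M = M and x = x and t = t] by (simp add: c_def[symmetric] c)
  have "inj (\<lambda>n. h + int n)" by (auto simp: inj_def)
  then have "infinite (range (\<lambda>n. h + int n))" by (simp add: finite_image_iff)
  then have "\<not> range (\<lambda>n. h + int n) \<subseteq> {i. tape i \<noteq> 0}"
    using fin finite_subset by blast
  then obtain m where "tape (h + int m) = 0" by auto
  then have "tape (h + int m) \<notin> range bit_symbol" by (auto simp: bit_symbol_def)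
  then obtain n where n: "tape (h + int n) \<notin> range bit_symbol"
    and least: "\<And>i. i < n \<Longrightarrow> tape (h + int i) \<in> range bit_symbol"
    using exists_least_iff[of "\<lambda>n. tape (h + int n) \<notin> range bit_symbol"] by blast
  have "has_output c (map (\<lambda>i. tape (h + int i) = 2) [0..<n])"
    using n least by (fastforce simp: has_output_def c bit_symbol_def split: if_splits)
  then show ?thesis ..
qed


section \<open>Ranking and compression\<close>

definition rank :: "str set \<Rightarrow> str \<Rightarrow> nat" where
  "rank A y = card {z. z \<le> y \<and> z \<in> A}"

definition ranking_function :: "(str \<rightharpoonup> str) \<Rightarrow> str set \<Rightarrow> bool" where
  "ranking_function f A \<longleftrightarrow>
     A \<subseteq> dom f \<and> (\<forall>x\<in>A. nat_of_str (the (f x)) = rank A x)"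

definition P_rankable :: "str set \<Rightarrow> bool" where
  "P_rankable A \<longleftrightarrow>
     (\<exists>f. poly_time_computable f \<and> ranking_function (\<lambda>x. Some (f x)) A)"

definition compression_function :: "(str \<rightharpoonup> str) \<Rightarrow> str set \<Rightarrow> bool" where
  "compression_function f A \<longleftrightarrow>
     A \<subseteq> dom f \<and> (\<lambda>x. the (f x)) ` A = UNIV \<and> inj_on (\<lambda>x. the (f x)) A"

definition F_PR_compressible :: "str set \<Rightarrow> bool" where
  "F_PR_compressible A \<longleftrightarrow> (\<exists>f. partial_recursive f \<and> compression_function f A)"

end

theory Submission
  imports Defs "HOL-Library.Countable_Set"
begin

text \<open>
  For \<open>c :: nat \<Rightarrow> bool \<times> bool\<close> let the set belonging to \<open>c\<close> consist of the strings
  \<open>a b w\<close> with \<open>w\<close> nonempty and \<open>c \<bar>w\<bar> = (a, b)\<close>. Deleting the first two letters is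
  an order isomorphism from this set onto the nonempty strings, so it ranks the set, whatever
  \<open>c\<close> is. As there are only countably many machines, \<open>c\<close> can be built by finite extension,
  each step defeating one function \<open>g\<close>: either some extension of the current condition puts into
  the complement two strings that \<open>g\<close> identifies, and this is preserved by fixing finitely many
  values; or \<open>g\<close> is injective on the complement for all extensions. In the latter case put some
  string \<open>x\<close> into the set. If \<open>g x = g y\<close> for some \<open>y\<close> in the complement, then a third
  choice of the prefix at the length of \<open>x\<close> leaves both \<open>x\<close> and \<open>y\<close> in the complement,
  contradicting injectivity; hence the value \<open>g x\<close> is missed. Two deleted letters are needed so
  that there are more than two prefixes to choose from.
\<close>

text \<open>Excluding the empty \<open>w\<close> makes the rank of \<open>a # b # w\<close> exactly
  \<open>nat_of_str w\<close>, where the empty string has number 0.\<close>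

definition prefixed_set :: "(nat \<Rightarrow> bool \<times> bool) \<Rightarrow> str set" where
  "prefixed_set c = {a # b # w | a b w. w \<noteq> [] \<and> c (length w) = (a, b)}"

lemma Cons_Cons_in_prefixed_set [simp]:
  "a # b # w \<in> prefixed_set c \<longleftrightarrow> w \<noteq> [] \<and> c (length w) = (a, b)"
  by (auto simp: prefixed_set_def)

lemma prefixed_setE:
  assumes "x \<in> prefixed_set c"
  obtains a b w where "x = a # b # w" "w \<noteq> []" "c (length w) = (a, b)"
  using assms by (auto simp: prefixed_set_def)

definition add_prefix :: "(nat \<Rightarrow> bool \<times> bool) \<Rightarrow> str \<Rightarrow> str" where
  "add_prefix c w = fst (c (length w)) # snd (c (length w)) # w"

lemma inj_add_prefix: "inj (add_prefix c)"
  by (auto simp: inj_def add_prefix_def)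

lemma prefixed_set_eq_image: "prefixed_set c = add_prefix c ` (- {[]})"
  by (auto simp: add_prefix_def elim!: prefixed_setE intro!: image_eqI)

text \<open>Strings of equal length receive the same prefix; for different lengths the order is
  decided by length alone.\<close>

lemma add_prefix_le_iff: "add_prefix c v \<le> add_prefix c w \<longleftrightarrow> v \<le> w"
proof (cases "length v = length w")
  case True
  then show ?thesis by (simp add: add_prefix_def Cons_le_Cons)
next
  case False
  moreover have "v < w" if "length v < length w"
    using that str_le_length[of w v] by force
  ultimately show ?thesis
    using str_le_length[of v w] by (auto simp: add_prefix_def Cons_le_Cons)
qed

lemma infinite_prefixed_set: "infinite (prefixed_set c)"
proof -
  have "infinite (- {[] :: str})"
    by (simp add: finite_compl infinite_UNIV_listI)
  then show ?thesis
    unfolding prefixed_set_eq_image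
    by (meson finite_imageD inj_add_prefix inj_on_subset subset_UNIV)
qed

lemma infinite_compl_prefixed_set: "infinite (- prefixed_set c)"
proof -
  define d where "d = (\<lambda>n. (\<not> fst (c n), snd (c n)))"
  have "prefixed_set d \<subseteq> - prefixed_set c"
    by (auto simp: d_def prod_eq_iff elim!: prefixed_setE)
  then show ?thesis
    using infinite_prefixed_set infinite_super by blast
qed

lemma rank_prefixed_set:
  assumes "x \<in> prefixed_set c"
  shows "rank (prefixed_set c) x = nat_of_str (drop 2 x)"
proof -
  obtain w where "w \<noteq> []" and x: "x = add_prefix c w"
    using assms by (auto simp: prefixed_set_eq_image)
  have "{z. z \<le> x \<and> z \<in> prefixed_set c} = add_prefix c ` ({v. v \<le> w} - {[]})"
    by (auto simp: x prefixed_set_eq_image add_prefix_le_iff)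
  then have "rank (prefixed_set c) x = card ({v. v \<le> w} - {[]})"
    by (simp add: rank_def card_image inj_on_subset[OF inj_add_prefix])
  \<comment> \<open>Removing the least string \<open>[]\<close> leaves as many strings as removing
    the greatest, \<open>w\<close>.\<close>
  also have "\<dots> = card {v. v \<le> w} - 1"
    by (simp add: finite_str_le)
  also have "{v. v \<le> w} - {w} = {v. v < w}"
    by auto
  then have "card {v. v \<le> w} - 1 = card {v. v < w}"
    using card_Diff_singleton[of w "{v. v \<le> w}"] by simp
  finally show ?thesis
    by (simp add: nat_of_str_def x add_prefix_def)
qed

text \<open>Output is read from the head, so moving right twice deletes two letters. The blank 0 is
  passed over as well, which covers inputs shorter than two letters.\<close>

definition skip_two :: tm where
  "skip_two = fmap_of_list
     [((q, s), (Suc q, s, Move_Right)). q \<leftarrow> [0, 1], s \<leftarrow> [0, 1, 2]]"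

lemma fmlookup_skip_two:
  "fmlookup skip_two (q, s) =
     (if q \<in> {0, 1} \<and> s \<in> {0, 1, 2} then Some (Suc q, s, Move_Right) else None)"
  by (simp add: skip_two_def fmlookup_of_list)

lemma computes_in_skip_two: "computes_in skip_two x 2 (drop 2 x)"
proof -
  obtain tape where c: "init_config x = (0, 0, tape)"
    and tape: "tape = (\<lambda>i. if 0 \<le> i \<and> i < int (length x) then bit_symbol (x ! nat i) else 0)"
    by (simp add: init_config_def)
  have symb: "tape i \<in> {0, 1, 2}" for i
    by (simp add: tape bit_symbol_def)
  have step: "step skip_two (q, h, tape) = (Suc q, h + 1, tape)" if "q < 2" for q h
    using symb[of h] that
    by (simp add: step_def fmlookup_skip_two less_2_cases_iff)
  have "(step skip_two ^^ 2) (init_config x) = (2, 2, tape)"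
    by (simp add: c step numeral_2_eq_2)
  moreover have "halted skip_two (2, 2, tape)"
    by (simp add: halted_def fmlookup_skip_two)
  moreover have "has_output (2, 2, tape) (drop 2 x)"
    by (auto simp: has_output_def tape bit_symbol_def nat_add_distrib)
  ultimately show ?thesis
    by (simp add: computes_in_def)
qed

lemma poly_time_computable_drop_two: "poly_time_computable (drop 2)"
  unfolding poly_time_computable_def
  using computes_in_skip_two
  by (intro exI[of _ skip_two] exI[of _ "[:2:]"]) auto

lemma P_rankable_prefixed_set: "P_rankable (prefixed_set c)"
  unfolding P_rankable_def ranking_function_def
  using poly_time_computable_drop_two rank_prefixed_set
  by (intro exI[of _ "drop 2"]) auto

instance direction :: countable
  by countable_datatype

lemma countable_partial_recursive: "countable {f. partial_recursive f}"
proof -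
  define F where "F M x = (if \<exists>v t. computes_in M x t v
    then Some (THE v. \<exists>t. computes_in M x t v) else None)" for M x
  have "f = F M" if M: "\<And>x v. f x = Some v \<longleftrightarrow> (\<exists>t. computes_in M x t v)" for f M
  proof
    fix x
    show "f x = F M x"
      by (cases "f x") (auto simp: F_def M[symmetric])
  qed
  then have "{f. partial_recursive f} \<subseteq> range F"
    unfolding partial_recursive_def by blast
  then show ?thesis
    by (rule countable_subset) simp
qed

text \<open>A Baire category argument: each \<open>P n\<close> holds on a dense open set of
  sequences, for the product of discrete topologies.\<close>

lemma finite_extension_construction:
  fixes P :: "nat \<Rightarrow> (nat \<Rightarrow> 'a) \<Rightarrow> bool"
  assumes "\<And>n c N. \<exists>c' M. (\<forall>i<N. c' i = c i) \<and> (\<forall>d. (\<forall>i<M. d i = c' i) \<longrightarrow> P n d)"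
  shows "\<exists>d. \<forall>n. P n d"
proof -
  \<comment> \<open>A pair \<open>s\<close> is a finite condition: only the values of
    \<open>fst s\<close> below \<open>snd s\<close> are committed.\<close>
  define R where "R n s s' \<longleftrightarrow> snd s < snd s' \<and> (\<forall>i<snd s. fst s' i = fst s i) \<and>
    (\<forall>d. (\<forall>i<snd s'. d i = fst s' i) \<longrightarrow> P n d)" for n and s s' :: "(nat \<Rightarrow> 'a) \<times> nat"
  have "\<exists>s'. True \<and> R n s s'" for n s
  proof -
    obtain c' M where "\<forall>i<snd s. c' i = fst s i" "\<forall>d. (\<forall>i<M. d i = c' i) \<longrightarrow> P n d"
      using assms[where c = "fst s" and N = "snd s" and n = n] by blast
    then have "R n s (c', Suc (max M (snd s)))"
      by (auto simp: R_def)
    then show ?thesis by blast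
  qed
  then obtain s where s: "\<And>n. R n (s n) (s (Suc n))"
    using dependent_nat_choice[where P = "\<lambda>_ _. True" and Q = R] by blast
  have mono: "strict_mono (\<lambda>n. snd (s n))"
    using s by (simp add: strict_mono_Suc_iff R_def)
  have agree: "fst (s m) i = fst (s n) i" if "n \<le> m" "i < snd (s n)" for m n i
    using that
  proof (induction m rule: dec_induct)
    case (step m)
    then have "i < snd (s m)"
      using mono by (meson order.strict_trans2 strict_mono_less_eq)
    then show ?case using s[of m] step by (simp add: R_def)
  qed simp
  \<comment> \<open>Since \<open>snd (s n)\<close> is at least \<open>n\<close>, stage
    \<open>Suc i\<close> has already committed the value at \<open>i\<close>.\<close>
  define d where "d i = fst (s (Suc i)) i" for i
  have "d i = fst (s n) i" if "i < snd (s n)" for n i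
  proof -
    have "i < snd (s (Suc i))"
      using strict_mono_imp_increasing[OF mono, of "Suc i"] by simp
    then show ?thesis
      using agree[of n "Suc i" i] agree[of "Suc i" n i] that
      by (cases "n \<le> Suc i") (auto simp: d_def)
  qed
  then have "P n d" for n
    using s[of n] by (simp add: R_def)
  then show ?thesis by blast
qed

lemma ex_third_pair: "\<exists>q :: bool \<times> bool. q \<noteq> p \<and> q \<noteq> p'"
proof -
  have "card {p, p'} < card (UNIV :: (bool \<times> bool) set)"
    by (simp add: card_insert_if card_UNIV_bool flip: UNIV_Times_UNIV)
  then have "{p, p'} \<noteq> UNIV" by auto
  then show ?thesis by blast
qed

text \<open>Truncated subtraction is harmless: strings shorter than two letters lie in neither
  set.\<close>

lemma in_prefixed_set_cong:
  assumes "d (length x - 2) = c (length x - 2)"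
  shows "x \<in> prefixed_set d \<longleftrightarrow> x \<in> prefixed_set c"
  using assms by (auto elim!: prefixed_setE)

lemma extension_defeating_function:
  "\<exists>c' M. (\<forall>i<N. c' i = c i) \<and> (\<forall>d. (\<forall>i<M. d i = c' i) \<longrightarrow>
    \<not> compression_function f (- prefixed_set d))"
proof -
  define g where "g = (\<lambda>x. the (f x))"
  have compress: "g ` B = UNIV \<and> inj_on g B" if "compression_function f B" for B
    using that by (simp add: compression_function_def g_def)
  show ?thesis
  proof (cases "\<forall>d. (\<forall>i<N. d i = c i) \<longrightarrow> inj_on g (- prefixed_set d)")
    case False
    then obtain c' x y where c': "\<forall>i<N. c' i = c i" "x \<notin> prefixed_set c'" "y \<notin> prefixed_set c'"
      and xy: "x \<noteq> y" "g x = g y"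
      unfolding inj_on_def by blast
    define M where "M = Suc (max (length x) (length y))"
    have "\<not> compression_function f (- prefixed_set d)" if "\<forall>i<M. d i = c' i" for d
    proof -
      have "x \<notin> prefixed_set d" "y \<notin> prefixed_set d"
        using that c' in_prefixed_set_cong[of d _ c'] by (simp_all add: M_def)
      then show ?thesis using xy compress by (auto simp: inj_on_def)
    qed
    then show ?thesis using c' by blast
  next
    case True
    \<comment> \<open>The index \<open>Suc N\<close> is still free, and \<open>w\<close> is nonempty
      even for \<open>N = 0\<close>.\<close>
    define w where "w = replicate (Suc N) False"
    define x where "x = False # False # w"
    define c' where "c' = c(Suc N := (False, False))"
    have "\<not> compression_function f (- prefixed_set d)"
      if d: "\<forall>i<Suc (Suc N). d i = c' i" for d
    proof
      assume "compression_function f (- prefixed_set d)"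
      then have "g ` (- prefixed_set d) = UNIV"
        using compress by blast
      then obtain y where y: "y \<notin> prefixed_set d" "g y = g x"
        by (metis ComplD UNIV_I imageE)
      have x: "x \<in> prefixed_set d"
        using d by (simp add: x_def w_def c'_def)
      obtain q where q: "q \<noteq> (False, False)" "q \<noteq> (y ! 0, y ! 1)"
        using ex_third_pair by blast
      \<comment> \<open>The change expels \<open>x\<close> and cannot admit \<open>y\<close>,
        whatever its length, so \<open>x\<close> and \<open>y\<close> contradict injectivity for
        \<open>e\<close>.\<close>
      define e where "e = d(Suc N := q)"
      have "x \<notin> prefixed_set e"
        using q by (simp add: x_def w_def e_def)
      moreover have "y \<notin> prefixed_set e"
        using y q by (auto simp: e_def elim!: prefixed_setE split: if_splits)
      moreover have "\<forall>i<N. e i = c i"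
        using d by (simp add: e_def c'_def)
      ultimately have "x = y"
        using True y by (auto dest: inj_onD)
      then show False using x y by simp
    qed
    moreover have "\<forall>i<N. c' i = c i"
      by (simp add: c'_def)
    ultimately show ?thesis by blast
  qed
qed

theorem theorem22:
  shows "\<exists>A :: str set. infinite A \<and> P_rankable A \<and>
           infinite (- A) \<and> \<not> F_PR_compressible (- A)"
proof -
  define F where "F = from_nat_into {f. partial_recursive f}"
  have "\<exists>d. \<forall>n. \<not> compression_function (F n) (- prefixed_set d)"
    by (rule finite_extension_construction) (rule extension_defeating_function)
  then obtain d where d: "\<And>n. \<not> compression_function (F n) (- prefixed_set d)"
    by blast
  have "\<not> compression_function f (- prefixed_set d)" if "partial_recursive f" for f
    using from_nat_into_surj[OF countable_partial_recursive, of f] that d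
    by (auto simp: F_def)
  then have "\<not> F_PR_compressible (- prefixed_set d)"
    by (auto simp: F_PR_compressible_def)
  then show ?thesis
    using infinite_prefixed_set infinite_compl_prefixed_set P_rankable_prefixed_set by blast
qed

end
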